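(* Assume $\kappa$ is a regular cardinal and $\Box(\kappa)$ holds. Then there is a Fréchet $\alpha_1$-space $X$ such that $t(X_\delta)=\kappa$.
   Context: Cardinals called regular are infinite. $\Box(\kappa)$ is the statement that there exists a sequence $\langle C_\alpha:\alpha<\kappa\rangle$ such that: $C_\alpha$ is club (closed and unbounded) in $\alpha$ for $\alpha$ limit; $C_{\alpha+1}=\{\alpha\}$; $C_\alpha\cap\beta=C_\beta$ for every $\beta$ which is a limit point of $C_\alpha$; and there is no club $C$ in $\kappa$ such that $C\cap\alpha=C_\alpha$ for every $\alpha<\kappa$ which is a limit point of $C$. For a topological space $X$, the $G_\delta$-modification $X_\delta$ is the space with the same underlying set as $X$ and with the $G_\delta$ subsets of $X$ as a base for its topology. Tightness: for a point $x$ of a space $X$, $t(x,X)$ is the minimum cardinal $\lambda$ such that for every $A\subseteq X$ with $x\in\overline{A}$ there is $B\subseteq A$ with $|B|\le\lambda$ and $x\in\overline{B}$. The tightness of $X$ is $t(X)=\sup_{x\in X}t(x,X)$. A point $x\in X$ is Fréchet if for every $A\subseteq X$, $x\in\overline{A}$ if and only if there is a sequence $\{x_n:n<\omega\}\subseteq A$ converging to $x$. A point $x\in X$ is $\alpha_1$ if for every countable collection of sequences converging to $x$ there is another sequence converging to $x$ which, modulo finite sets, contains each of them (sequences are identified with their ranges). The space $X$ is Fréchet (respectively an $\alpha_1$-space) if every point of $X$ is Fréchet (respectively $\alpha_1$); a Fréchet $\alpha_1$-space is one with both properties. *)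

theory Defs
  imports "HOL-Analysis.Analysis"
begin

unbundle cardinal_syntax

(* An infinite cardinal is a relation \<kappa> with Cinfinite \<kappa>. The ordinals below \<kappa> are the
   elements of Field \<kappa>, and the ordinal \<alpha> as a set of smaller ordinals is underS \<kappa> \<alpha>. *)

(* Zero is not a limit point, because underS \<kappa> \<beta> is required to be nonempty. *)
definition limit_points :: "'a rel \<Rightarrow> 'a set \<Rightarrow> 'a set" where
  "limit_points \<kappa> C = {\<beta> \<in> Field \<kappa>. underS \<kappa> \<beta> \<noteq> {} \<and>
     (\<forall>\<gamma> \<in> underS \<kappa> \<beta>. \<exists>\<delta> \<in> C \<inter> underS \<kappa> \<beta>. \<gamma> \<in> underS \<kappa> \<delta>)}"

abbreviation limit_ordinals :: "'a rel \<Rightarrow> 'a set" where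
  "limit_ordinals \<kappa> \<equiv> limit_points \<kappa> (Field \<kappa>)"

(* D is either Field \<kappa> (clubs in \<kappa>) or underS \<kappa> \<alpha> (clubs in a limit ordinal \<alpha> < \<kappa>). *)
definition club_in :: "'a rel \<Rightarrow> 'a set \<Rightarrow> 'a set \<Rightarrow> bool" where
  "club_in \<kappa> D C \<longleftrightarrow> C \<subseteq> D \<and> limit_points \<kappa> C \<inter> D \<subseteq> C \<and>
     (\<forall>\<gamma> \<in> D. \<exists>\<delta> \<in> C. \<gamma> \<in> underS \<kappa> \<delta>)"

(* wo_rel.suc \<kappa> {\<alpha>} is \<alpha> + 1. *)
definition square :: "'a rel \<Rightarrow> bool" where
  "square \<kappa> \<longleftrightarrow> (\<exists>C :: 'a \<Rightarrow> 'a set.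
     (\<forall>\<alpha> \<in> limit_ordinals \<kappa>. club_in \<kappa> (underS \<kappa> \<alpha>) (C \<alpha>)) \<and>
     (\<forall>\<alpha> \<in> Field \<kappa>. C (wo_rel.suc \<kappa> {\<alpha>}) = {\<alpha>}) \<and>
     (\<forall>\<alpha> \<in> Field \<kappa>. \<forall>\<beta> \<in> limit_points \<kappa> (C \<alpha>). C \<alpha> \<inter> underS \<kappa> \<beta> = C \<beta>) \<and>
     \<not> (\<exists>E. club_in \<kappa> (Field \<kappa>) E \<and>
          (\<forall>\<alpha> \<in> limit_points \<kappa> E. E \<inter> underS \<kappa> \<alpha> = C \<alpha>)))"

definition G_delta_modification :: "'a topology \<Rightarrow> 'a topology" where
  "G_delta_modification X = topology (arbitrary union_of (gdelta_in X))"

lemma openin_G_delta_modification: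
  "openin (G_delta_modification X) = arbitrary union_of (gdelta_in X)"
  unfolding G_delta_modification_def
  by (rule topology_inverse') (rule istopology_base, rule gdelta_in_Int)

lemma topspace_G_delta_modification [simp]:
  "topspace (G_delta_modification X) = topspace X"
proof
  show "topspace (G_delta_modification X) \<subseteq> topspace X"
    unfolding topspace_def[of "G_delta_modification X"] openin_G_delta_modification
    by (auto simp: union_of_def dest: gdelta_in_subset)
  show "topspace X \<subseteq> topspace (G_delta_modification X)"
    by (rule openin_subset)
       (simp add: openin_G_delta_modification arbitrary_union_of_inc)
qed

(* Minima and suprema of cardinals; the cardinals of type 'a rel are, up to =o, exactly those of
   size at most UNIV :: 'a set, which suffices for invariants of spaces with points in 'a. *)
definition least_cardinal :: "('a rel \<Rightarrow> bool) \<Rightarrow> 'a rel" where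
  "least_cardinal P =
     (SOME r. Card_order r \<and> P r \<and> (\<forall>s. Card_order s \<and> P s \<longrightarrow> r \<le>o s))"

lemma least_cardinal:
  assumes "Card_order t" "P t"
  shows "Card_order (least_cardinal P)" "P (least_cardinal P)"
    "\<And>s. Card_order s \<Longrightarrow> P s \<Longrightarrow> least_cardinal P \<le>o s"
proof -
  have "\<exists>r \<in> {r. Card_order r \<and> P r}. \<forall>s \<in> {r. Card_order r \<and> P r}. r \<le>o s"
    using assms by (intro exists_minim_Card_order) auto
  then have "\<exists>r. Card_order r \<and> P r \<and> (\<forall>s. Card_order s \<and> P s \<longrightarrow> r \<le>o s)"
    by blast
  from someI_ex[OF this, folded least_cardinal_def]
  show "Card_order (least_cardinal P)" "P (least_cardinal P)"
    "\<And>s. Card_order s \<Longrightarrow> P s \<Longrightarrow> least_cardinal P \<le>o s"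
    by blast+
qed

definition tight_at :: "'a topology \<Rightarrow> 'a \<Rightarrow> 'a rel \<Rightarrow> bool" where
  "tight_at X x r \<longleftrightarrow> (\<forall>A \<subseteq> topspace X. x \<in> X closure_of A \<longrightarrow>
     (\<exists>B \<subseteq> A. |B| \<le>o r \<and> x \<in> X closure_of B))"

definition tightness_at :: "'a \<Rightarrow> 'a topology \<Rightarrow> 'a rel" where
  "tightness_at x X = least_cardinal (tight_at X x)"

definition tightness :: "'a topology \<Rightarrow> 'a rel" where
  "tightness X = least_cardinal (\<lambda>r. \<forall>x \<in> topspace X. tightness_at x X \<le>o r)"

lemma tight_at_UNIV: "tight_at X x |UNIV :: 'a set|" for X :: "'a topology"
  unfolding tight_at_def using card_of_mono1 by blast

lemma tightness_at_least:
  fixes X :: "'a topology"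
  shows "Card_order (tightness_at x X)" "tight_at X x (tightness_at x X)"
    "\<And>s :: 'a rel. Card_order s \<Longrightarrow> tight_at X x s \<Longrightarrow> tightness_at x X \<le>o s"
  unfolding tightness_at_def
  by (rule least_cardinal[where P = "tight_at X x", OF card_of_Card_order tight_at_UNIV]; assumption)+

lemma tightness_at_le_UNIV: "tightness_at x X \<le>o |UNIV :: 'a set|" for X :: "'a topology"
  by (rule tightness_at_least(3)[OF card_of_Card_order tight_at_UNIV])

lemma tightness_least:
  fixes X :: "'a topology"
  shows "Card_order (tightness X)"
    "\<And>x. x \<in> topspace X \<Longrightarrow> tightness_at x X \<le>o tightness X"
    "\<And>s :: 'a rel. Card_order s \<Longrightarrow> (\<And>x. x \<in> topspace X \<Longrightarrow> tightness_at x X \<le>o s) \<Longrightarrow>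
       tightness X \<le>o s"
proof -
  let ?P = "\<lambda>r :: 'a rel. \<forall>x \<in> topspace X. tightness_at x X \<le>o r"
  have "?P |UNIV :: 'a set|"
    by (intro ballI tightness_at_le_UNIV)
  note * = least_cardinal[where P = ?P, OF card_of_Card_order this, folded tightness_def]
  show "Card_order (tightness X)"
    "\<And>x. x \<in> topspace X \<Longrightarrow> tightness_at x X \<le>o tightness X"
    "\<And>s :: 'a rel. Card_order s \<Longrightarrow> (\<And>x. x \<in> topspace X \<Longrightarrow> tightness_at x X \<le>o s) \<Longrightarrow>
       tightness X \<le>o s"
    using * by blast+
qed

definition Frechet_point :: "'a topology \<Rightarrow> 'a \<Rightarrow> bool" where
  "Frechet_point X x \<longleftrightarrow> (\<forall>A \<subseteq> topspace X. x \<in> X closure_of A \<longleftrightarrow>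
     (\<exists>s :: nat \<Rightarrow> 'a. range s \<subseteq> A \<and> limitin X s x sequentially))"

(* limitin only constrains a tail of the sequence, hence the condition on the range. *)
definition converging_seqs :: "'a topology \<Rightarrow> 'a \<Rightarrow> (nat \<Rightarrow> 'a) set" where
  "converging_seqs X x = {s. range s \<subseteq> topspace X \<and> limitin X s x sequentially}"

definition alpha1_point :: "'a topology \<Rightarrow> 'a \<Rightarrow> bool" where
  "alpha1_point X x \<longleftrightarrow> (\<forall>S \<subseteq> converging_seqs X x. countable S \<longrightarrow>
     (\<exists>t \<in> converging_seqs X x. \<forall>s \<in> S. finite (range s - range t)))"

definition Frechet_space :: "'a topology \<Rightarrow> bool" where
  "Frechet_space X \<longleftrightarrow> (\<forall>x \<in> topspace X. Frechet_point X x)"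

definition alpha1_space :: "'a topology \<Rightarrow> bool" where
  "alpha1_space X \<longleftrightarrow> (\<forall>x \<in> topspace X. alpha1_point X x)"

end

(* The walk length rho (Todorcevic's rho_2) of a square sequence is coherent: for \<alpha> < \<beta> the functions
   rho(., \<alpha>) and rho(., \<beta>) differ by a bounded amount below \<alpha>. Call a set B slow if each rho(., \<beta>)
   is bounded on B below \<beta>. An unbounded slow set would yield a thread, so slow sets are bounded. The space
   has one nonisolated point, whose neighbourhoods are the complements of slow sets. By coherence a sequence
   bounded by \<beta> converges to it as soon as rho(., \<beta>) tends to infinity along it, and this single test gives
   both the Frechet property and the diagonal sequence for alpha_1. A set bounded by \<beta> is the countable union
   of the slow sets on which rho(., \<beta>) \<le> m, while no unbounded set is a countable union of slow sets; hence
   in the G_delta-modification the point is in the closure of the rest, but of no set of size < \<kappa>. *)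

theory Submission
  imports Defs
begin

section \<open>Regular cardinals\<close>

locale regular_cardinal =
  fixes \<kappa> :: "'a rel"
  assumes Cinfinite: "Cinfinite \<kappa>" and regular: "regularCard \<kappa>"
begin

abbreviation K :: "'a set" where "K \<equiv> Field \<kappa>"

abbreviation lt :: "'a \<Rightarrow> 'a \<Rightarrow> bool"  (infix "\<sqsubset>" 50) where
  "x \<sqsubset> y \<equiv> x \<in> underS \<kappa> y"

sublocale wo_rel \<kappa>
  using Cinfinite by (simp add: wo_rel_def card_order_on_def)

lemma Card_order: "Card_order \<kappa>"
  using Cinfinite by simp

lemma Field_nonempty: "K \<noteq> {}"
  using Cinfinite by (auto simp: cinfinite_def)

lemma lt_Field: "x \<sqsubset> y \<Longrightarrow> x \<in> K" "x \<sqsubset> y \<Longrightarrow> y \<in> K"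
  by (auto simp: underS_def Field_def)

lemma lt_irrefl [simp]: "\<not> x \<sqsubset> x"
  by (simp add: underS_def)

lemma lt_trans: "x \<sqsubset> y \<Longrightarrow> y \<sqsubset> z \<Longrightarrow> x \<sqsubset> z"
  using TRANS ANTISYM by (auto simp: underS_def trans_def antisym_def)

lemma lt_linear: "x \<in> K \<Longrightarrow> y \<in> K \<Longrightarrow> x \<sqsubset> y \<or> x = y \<or> y \<sqsubset> x"
  using TOTALS by (auto simp: underS_def)

lemma lt_le_trans: "x \<sqsubset> y \<Longrightarrow> \<not> z \<sqsubset> y \<Longrightarrow> z \<in> K \<Longrightarrow> x \<sqsubset> z"
  using lt_linear lt_trans lt_Field by metis

lemma le_lt_trans: "\<not> y \<sqsubset> x \<Longrightarrow> x \<in> K \<Longrightarrow> y \<sqsubset> z \<Longrightarrow> x \<sqsubset> z"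
  using lt_linear lt_trans lt_Field by metis

lemma wf_lt: "wf {(x, y). x \<sqsubset> y}"
proof -
  have "{(x, y). x \<sqsubset> y} = \<kappa> - Id"
    by (auto simp: underS_def)
  then show ?thesis using WF by simp
qed

lemma lt_induct: "(\<And>x. (\<And>y. y \<sqsubset> x \<Longrightarrow> P y) \<Longrightarrow> P x) \<Longrightarrow> P x"
  using wf_induct_rule[OF wf_lt, of P x] by blast

lemma ex_least: "x \<in> A \<Longrightarrow> \<exists>y\<in>A. \<forall>z\<in>A. \<not> z \<sqsubset> y"
  by (rule wfE_min[OF wf_lt, of x A]) auto

lemma ex_greater: "x \<in> K \<Longrightarrow> \<exists>y\<in>K. x \<sqsubset> y"
  using infinite_Card_order_limit[of \<kappa> x] Cinfinite by (auto simp: cinfinite_def underS_def)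

definition unbounded :: "'a set \<Rightarrow> bool" where
  "unbounded A \<longleftrightarrow> A \<subseteq> K \<and> (\<forall>\<gamma>\<in>K. \<exists>\<xi>\<in>A. \<gamma> \<sqsubset> \<xi>)"

lemma unbounded_Field: "unbounded K"
  using ex_greater by (auto simp: unbounded_def)

lemma unbounded_ordIso: "unbounded A \<Longrightarrow> |A| =o \<kappa>"
  using regular by (auto simp: unbounded_def regularCard_def cofinal_def underS_def)

lemma not_unbounded_bounded:
  assumes "A \<subseteq> K" "\<not> unbounded A"
  shows "\<exists>\<beta>\<in>K. A \<subseteq> underS \<beta>"
proof -
  from assms obtain \<gamma> where \<gamma>: "\<gamma> \<in> K" "\<And>\<xi>. \<xi> \<in> A \<Longrightarrow> \<not> \<gamma> \<sqsubset> \<xi>"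
    by (auto simp: unbounded_def)
  from ex_greater[OF \<gamma>(1)] obtain \<beta> where "\<beta> \<in> K" "\<gamma> \<sqsubset> \<beta>" by blast
  with \<gamma> assms(1) show ?thesis by (intro bexI[of _ \<beta>]) (auto intro: le_lt_trans)
qed

lemma small_bounded:
  assumes "A \<subseteq> K" "|A| <o \<kappa>"
  shows "\<exists>\<beta>\<in>K. A \<subseteq> underS \<beta>"
  using not_unbounded_bounded[OF assms(1)] unbounded_ordIso assms(2) not_ordLess_ordIso by blast

end

section \<open>Walks along a square sequence\<close>

locale square_sequence = regular_cardinal +
  fixes C :: "'a \<Rightarrow> 'a set"
  assumes club: "\<alpha> \<in> limit_ordinals \<kappa> \<Longrightarrow> club_in \<kappa> (underS \<alpha>) (C \<alpha>)"
    and successor: "\<alpha> \<in> K \<Longrightarrow> C (suc {\<alpha>}) = {\<alpha>}"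
    and coherent: "\<alpha> \<in> K \<Longrightarrow> \<beta> \<in> limit_points \<kappa> (C \<alpha>) \<Longrightarrow> C \<alpha> \<inter> underS \<beta> = C \<beta>"
    and no_thread: "club_in \<kappa> K E \<Longrightarrow> \<exists>\<alpha>\<in>limit_points \<kappa> E. E \<inter> underS \<alpha> \<noteq> C \<alpha>"
begin

lemma limit_pointsD:
  assumes "\<beta> \<in> limit_points \<kappa> A"
  shows "\<beta> \<in> K" "\<exists>\<gamma>. \<gamma> \<sqsubset> \<beta>" "\<gamma> \<sqsubset> \<beta> \<Longrightarrow> \<exists>\<delta>\<in>A. \<delta> \<sqsubset> \<beta> \<and> \<gamma> \<sqsubset> \<delta>"
  using assms by (auto simp: limit_points_def)

lemma limit_points_mono: "A \<inter> underS \<beta> \<subseteq> B \<Longrightarrow> \<beta> \<in> limit_points \<kappa> A \<Longrightarrow> \<beta> \<in> limit_points \<kappa> B"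
  unfolding limit_points_def by blast

text \<open>Uncountable cofinality comes from the absence of a thread. If a countable set were
  unbounded, regularity would make \<kappa> countable, so no limit ordinals would lie below it; then
  \<open>K\<close> is a club without limit points and is vacuously a thread.\<close>

lemma countable_bounded:
  assumes "A \<subseteq> K" "countable A"
  shows "\<exists>\<beta>\<in>K. A \<subseteq> underS \<beta>"
proof (rule not_unbounded_bounded[OF assms(1)], rule notI)
  assume "unbounded A"
  then have "\<kappa> =o |A|" using unbounded_ordIso ordIso_symmetric by blast
  moreover have "|A| \<le>o natLeq" using assms(2) card_of_nat
    by (metis card_of_ordLeq countable_def ordLeq_ordIso_trans subset_UNIV)
  ultimately have \<kappa>: "\<kappa> \<le>o natLeq" by (rule ordIso_ordLeq_trans)
  have "limit_points \<kappa> K = {}"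
  proof (rule equals0I)
    fix \<alpha> assume \<alpha>: "\<alpha> \<in> limit_points \<kappa> K"
    then have "|underS \<alpha>| <o \<kappa>"
      using card_of_underS[OF Card_order] limit_pointsD(1) by blast
    \<comment> \<open>A finite nonempty initial segment has a largest element, which a limit ordinal
      does not allow.\<close>
    then have "finite (underS \<alpha>)"
      using \<kappa> finite_iff_ordLess_natLeq ordLess_ordLeq_trans by blast
    moreover have "\<exists>\<delta>. \<delta> \<sqsubset> \<alpha> \<and> \<gamma> \<sqsubset> \<delta>" if "\<gamma> \<sqsubset> \<alpha>" for \<gamma>
      using limit_pointsD(3)[OF \<alpha> that] by blast
    moreover have "underS \<alpha> \<noteq> {}" using limit_pointsD(2)[OF \<alpha>] by blast
    moreover have "asymp_on (underS \<alpha>) (\<sqsubset>)"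
      by (rule asymp_onI) (metis lt_trans lt_irrefl)
    moreover have "transp_on (underS \<alpha>) (\<sqsubset>)"
      by (rule transp_onI) (metis lt_trans)
    ultimately show False
      using Finite_Set.bex_max_element[of "underS \<alpha>" "(\<sqsubset>)"] lt_irrefl by metis
  qed
  moreover have "club_in \<kappa> K K"
    using ex_greater by (auto simp: club_in_def limit_points_def)
  ultimately show False using no_thread by blast
qed

text \<open>If every piece were bounded, the chosen bounds would form a countable set, itself
  bounded by \<open>countable_bounded\<close>.\<close>

lemma countable_union_unbounded:
  assumes "unbounded A" "A \<subseteq> (\<Union>n::nat. F n)"
  shows "\<exists>n. unbounded (A \<inter> F n)"
proof (rule ccontr)
  assume "\<not> ?thesis"
  then have "\<exists>\<beta>\<in>K. A \<inter> F n \<subseteq> underS \<beta>" for n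
    using not_unbounded_bounded[of "A \<inter> F n"] assms(1) by (auto simp: unbounded_def)
  then obtain b where b: "\<And>n. b n \<in> K" "\<And>n. A \<inter> F n \<subseteq> underS (b n)" by metis
  obtain \<beta> where \<beta>: "\<beta> \<in> K" "range b \<subseteq> underS \<beta>"
    using countable_bounded[of "range b"] b(1) by auto
  obtain \<xi> where "\<xi> \<in> A" "\<beta> \<sqsubset> \<xi>" using assms(1) \<beta>(1) by (auto simp: unbounded_def)
  then obtain n where "\<xi> \<in> A \<inter> F n" using assms(2) by blast
  then have "\<xi> \<sqsubset> b n" "b n \<sqsubset> \<beta>" using b(2)[of n] \<beta>(2) by auto
  then show False using \<open>\<beta> \<sqsubset> \<xi>\<close> lt_trans lt_irrefl by metis
qed

text \<open>This makes a walk from \<beta> towards \<xi> possible. The premise excludes \<beta> = 0,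
  about which \<open>club\<close> and \<open>successor\<close> say nothing.\<close>

lemma C_below:
  assumes "\<xi> \<sqsubset> \<beta>"
  shows "C \<beta> \<subseteq> underS \<beta>" "\<exists>\<eta>\<in>C \<beta>. \<not> \<eta> \<sqsubset> \<xi>"
proof -
  have \<beta>: "\<beta> \<in> K" using lt_Field assms by blast
  have "C \<beta> \<subseteq> underS \<beta> \<and> (\<exists>\<eta>\<in>C \<beta>. \<not> \<eta> \<sqsubset> \<xi>)"
  proof (cases "\<beta> \<in> limit_ordinals \<kappa>")
    case True
    from club[OF True] obtain \<eta> where "\<eta> \<in> C \<beta>" "\<xi> \<sqsubset> \<eta>" and *: "C \<beta> \<subseteq> underS \<beta>"
      using assms by (auto simp: club_in_def)
    then have "\<not> \<eta> \<sqsubset> \<xi>" using lt_trans lt_irrefl by metis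
    with * \<open>\<eta> \<in> C \<beta>\<close> show ?thesis by blast
  next
    case False
    \<comment> \<open>Being neither zero nor a limit, \<beta> has a largest predecessor
      \<gamma>.\<close>
    then obtain \<gamma> where \<gamma>: "\<gamma> \<sqsubset> \<beta>" "\<And>\<delta>. \<delta> \<sqsubset> \<beta> \<Longrightarrow> \<not> \<gamma> \<sqsubset> \<delta>"
      using \<beta> assms lt_Field(1) by (auto simp: limit_points_def)
    have "\<beta> = suc {\<gamma>}"
    proof (rule equals_suc_AboveS)
      show "{\<gamma>} \<subseteq> K" using \<gamma> lt_Field by blast
      show "\<beta> \<in> AboveS {\<gamma>}" using \<gamma>(1) \<beta> by (auto simp: AboveS_def underS_def)
      fix a' assume "a' \<in> AboveS {\<gamma>}"
      then have "\<gamma> \<sqsubset> a'" "a' \<in> K" by (auto simp: AboveS_def underS_def)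
      then have "\<not> a' \<sqsubset> \<beta>" using \<gamma>(2) by blast
      then show "(\<beta>, a') \<in> \<kappa>" using \<beta> \<open>a' \<in> K\<close> TOTALS by (auto simp: underS_def)
    qed
    then have "C \<beta> = {\<gamma>}" using successor \<gamma>(1) lt_Field by blast
    then show ?thesis using \<gamma> assms by auto
  qed
  then show "C \<beta> \<subseteq> underS \<beta>" "\<exists>\<eta>\<in>C \<beta>. \<not> \<eta> \<sqsubset> \<xi>" by blast+
qed

text \<open>The first step of the walk from \<beta> down to \<xi>, usually written as the minimum of
  \<open>C \<beta> - \<xi>\<close>.\<close>

definition is_next :: "'a \<Rightarrow> 'a \<Rightarrow> 'a \<Rightarrow> bool" where
  "is_next \<xi> \<beta> \<eta> \<longleftrightarrow> \<eta> \<in> C \<beta> \<and> \<not> \<eta> \<sqsubset> \<xi> \<and> (\<forall>\<zeta>\<in>C \<beta>. \<not> \<zeta> \<sqsubset> \<xi> \<longrightarrow> \<not> \<zeta> \<sqsubset> \<eta>)"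

definition nxt :: "'a \<Rightarrow> 'a \<Rightarrow> 'a" where
  "nxt \<xi> \<beta> = (SOME \<eta>. is_next \<xi> \<beta> \<eta>)"

lemma is_next_nxt:
  assumes "\<xi> \<sqsubset> \<beta>" shows "is_next \<xi> \<beta> (nxt \<xi> \<beta>)"
proof -
  obtain x where "x \<in> {\<eta>\<in>C \<beta>. \<not> \<eta> \<sqsubset> \<xi>}" using C_below(2)[OF assms] by blast
  from ex_least[OF this] have "\<exists>\<eta>. is_next \<xi> \<beta> \<eta>" by (auto simp: is_next_def)
  then show ?thesis unfolding nxt_def by (rule someI_ex)
qed

lemma nxt_lt:
  assumes "\<xi> \<sqsubset> \<beta>" shows "nxt \<xi> \<beta> \<sqsubset> \<beta>" "\<not> nxt \<xi> \<beta> \<sqsubset> \<xi>" "nxt \<xi> \<beta> \<in> C \<beta>"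
  using is_next_nxt[OF assms] C_below(1)[OF assms] by (auto simp: is_next_def)

lemma nxt_eqI:
  assumes "\<xi> \<sqsubset> \<beta>" "is_next \<xi> \<beta> \<eta>" shows "nxt \<xi> \<beta> = \<eta>"
proof -
  have "\<not> nxt \<xi> \<beta> \<sqsubset> \<eta>" "\<not> \<eta> \<sqsubset> nxt \<xi> \<beta>" "\<eta> \<sqsubset> \<beta>"
    using is_next_nxt[OF assms(1)] assms(2) C_below(1)[OF assms(1)] by (auto simp: is_next_def)
  then show ?thesis using lt_linear[of "nxt \<xi> \<beta>" \<eta>] nxt_lt(1)[OF assms(1)] lt_Field(1) by metis
qed

text \<open>The number of steps of the walk from \<beta> to \<xi>, by recursion on \<beta>. The walk
  never passes below \<xi>, so when it starts above \<xi> the default 0 is reached exactly at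
  \<xi>.\<close>

definition rho :: "'a \<Rightarrow> 'a \<Rightarrow> nat" where
  "rho \<xi> = wfrec {(x, y). x \<sqsubset> y} (\<lambda>f \<beta>. if \<xi> \<sqsubset> \<beta> then Suc (f (nxt \<xi> \<beta>)) else 0)"

lemma rho_step: "\<xi> \<sqsubset> \<beta> \<Longrightarrow> rho \<xi> \<beta> = Suc (rho \<xi> (nxt \<xi> \<beta>))"
  using def_wfrec[OF rho_def[THEN eq_reflection] wf_lt, of \<xi> \<beta>] nxt_lt(1)[of \<xi> \<beta>]
  by (simp add: cut_def)

text \<open>By coherence \<open>C \<beta>\<close> and \<open>C \<delta>\<close> agree below
  \<delta>, so the walks from \<beta> and from \<delta> to \<xi> have the same first step. The case
  \<beta> = \<delta> is included.\<close>

lemma rho_limit_point: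
  assumes "\<beta> \<in> K" "\<delta> \<in> limit_points \<kappa> (C \<beta>)" "\<xi> \<sqsubset> \<delta>" "\<not> \<beta> \<sqsubset> \<delta>"
  shows "rho \<xi> \<beta> = rho \<xi> \<delta>"
proof -
  have lt: "\<xi> \<sqsubset> \<beta>" using assms lt_le_trans by blast
  have eq: "C \<beta> \<inter> underS \<delta> = C \<delta>" using coherent assms by blast
  have "\<not> \<zeta> \<sqsubset> nxt \<xi> \<delta>" if "\<zeta> \<in> C \<beta>" "\<not> \<zeta> \<sqsubset> \<xi>" for \<zeta>
  proof
    assume "\<zeta> \<sqsubset> nxt \<xi> \<delta>"
    moreover from this have "\<zeta> \<in> C \<delta>" using that(1) eq nxt_lt(1)[OF assms(3)] lt_trans by blast
    ultimately show False using is_next_nxt[OF assms(3)] that(2) by (simp add: is_next_def)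
  qed
  then have "is_next \<xi> \<beta> (nxt \<xi> \<delta>)"
    using nxt_lt[OF assms(3)] eq by (auto simp: is_next_def)
  then have "nxt \<xi> \<beta> = nxt \<xi> \<delta>" by (rule nxt_eqI[OF lt])
  then show ?thesis using rho_step lt assms(3) by simp
qed

subsection \<open>Coherence\<close>

definition near :: "'a set \<Rightarrow> 'a \<Rightarrow> 'a \<Rightarrow> bool" where
  "near S \<alpha> \<beta> \<longleftrightarrow> (\<exists>m. \<forall>\<xi>\<in>S. rho \<xi> \<alpha> \<le> rho \<xi> \<beta> + m \<and> rho \<xi> \<beta> \<le> rho \<xi> \<alpha> + m)"

lemma near_refl: "near S \<alpha> \<alpha>"
  unfolding near_def by auto

lemma near_sym: "near S \<alpha> \<beta> \<Longrightarrow> near S \<beta> \<alpha>"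
  unfolding near_def by blast

lemma near_mono: "near S \<alpha> \<beta> \<Longrightarrow> T \<subseteq> S \<Longrightarrow> near T \<alpha> \<beta>"
  unfolding near_def by blast

lemma near_trans:
  assumes "near S \<alpha> \<beta>" "near S \<beta> \<gamma>" shows "near S \<alpha> \<gamma>"
proof -
  from assms obtain m n where
    "\<forall>\<xi>\<in>S. rho \<xi> \<alpha> \<le> rho \<xi> \<beta> + m \<and> rho \<xi> \<beta> \<le> rho \<xi> \<alpha> + m"
    "\<forall>\<xi>\<in>S. rho \<xi> \<beta> \<le> rho \<xi> \<gamma> + n \<and> rho \<xi> \<gamma> \<le> rho \<xi> \<beta> + n"
    unfolding near_def by blast
  then show ?thesis unfolding near_def by (intro exI[of _ "m + n"]) force
qed

lemma near_Un:
  assumes "near S \<alpha> \<beta>" "near T \<alpha> \<beta>" shows "near (S \<union> T) \<alpha> \<beta>"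
proof -
  from assms obtain m n where
    "\<forall>\<xi>\<in>S. rho \<xi> \<alpha> \<le> rho \<xi> \<beta> + m \<and> rho \<xi> \<beta> \<le> rho \<xi> \<alpha> + m"
    "\<forall>\<xi>\<in>T. rho \<xi> \<alpha> \<le> rho \<xi> \<beta> + n \<and> rho \<xi> \<beta> \<le> rho \<xi> \<alpha> + n"
    unfolding near_def by blast
  then show ?thesis unfolding near_def by (intro exI[of _ "m + n"]) force
qed

lemma near_singleton: "near {\<xi>} \<alpha> \<beta>"
  unfolding near_def by (intro exI[of _ "rho \<xi> \<alpha> + rho \<xi> \<beta>"]) auto

text \<open>Double induction, on \<beta> and inside it on \<alpha>. If \<alpha> is a limit point of
  \<open>C \<beta>\<close> the two functions agree. Otherwise \<open>C \<beta>\<close> has no point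
  strictly between some \<gamma> and \<alpha>, and the three ranges below, at and above \<gamma> are
  treated separately.\<close>

lemma near_lt: "\<alpha> \<sqsubset> \<beta> \<Longrightarrow> near (underS \<alpha>) \<alpha> \<beta>"
proof (induction \<beta> arbitrary: \<alpha> rule: lt_induct)
  case (1 \<beta>)
  note IH\<beta> = "1.IH"
  from "1.prems" show ?case
  proof (induction \<alpha> rule: lt_induct)
    case (1 \<alpha>)
    note IH\<alpha> = "1.IH"
    have \<alpha>\<beta>: "\<alpha> \<sqsubset> \<beta>" by fact
    then have K: "\<alpha> \<in> K" "\<beta> \<in> K" using lt_Field by blast+
    consider "underS \<alpha> = {}" | "\<alpha> \<in> limit_points \<kappa> (C \<beta>)"
      | \<gamma> where "\<gamma> \<sqsubset> \<alpha>" "\<And>\<delta>. \<delta> \<in> C \<beta> \<Longrightarrow> \<delta> \<sqsubset> \<alpha> \<Longrightarrow> \<not> \<gamma> \<sqsubset> \<delta>"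
      using K unfolding limit_points_def by blast
    then show ?case
    proof cases
      case 1
      then show ?thesis by (simp add: near_def)
    next
      case 2
      have "rho \<xi> \<beta> = rho \<xi> \<alpha>" if "\<xi> \<sqsubset> \<alpha>" for \<xi>
        using rho_limit_point[OF K(2) 2 that] \<alpha>\<beta> lt_trans lt_irrefl by metis
      then show ?thesis by (auto simp: near_def)
    next
      case 3
      \<comment> \<open>All walks from \<beta> into the interval \<open>?I\<close> begin with the
        step to \<open>?\<eta>\<close>, as \<open>C \<beta>\<close> skips the interval. This costs a
        constant 1, and the outer hypothesis compares \<open>?\<eta>\<close> with \<alpha>.\<close>
      let ?\<eta> = "nxt \<alpha> \<beta>" and ?I = "{\<xi>. \<gamma> \<sqsubset> \<xi> \<and> \<xi> \<sqsubset> \<alpha>}"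
      have \<eta>: "?\<eta> \<sqsubset> \<beta>" "\<not> ?\<eta> \<sqsubset> \<alpha>" "?\<eta> \<in> K" using nxt_lt[OF \<alpha>\<beta>] lt_Field by blast+
      have "near (underS \<alpha>) \<alpha> ?\<eta>"
      proof (cases "\<alpha> = ?\<eta>")
        case True
        then show ?thesis using near_refl by metis
      next
        case False
        then have "\<alpha> \<sqsubset> ?\<eta>" using lt_linear K \<eta> by blast
        then show ?thesis using IH\<beta> \<eta> by blast
      qed
      then have "near ?I \<alpha> ?\<eta>" by (rule near_mono) blast
      moreover have "near ?I ?\<eta> \<beta>"
      proof -
        have "rho \<xi> \<beta> = Suc (rho \<xi> ?\<eta>)" if "\<xi> \<in> ?I" for \<xi>
        proof -
          have \<xi>: "\<xi> \<sqsubset> \<beta>" using that \<alpha>\<beta> lt_trans by blast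
          have "\<not> \<zeta> \<sqsubset> \<alpha>" if "\<zeta> \<in> C \<beta>" "\<not> \<zeta> \<sqsubset> \<xi>" for \<zeta>
          proof
            assume "\<zeta> \<sqsubset> \<alpha>"
            then have "\<not> \<gamma> \<sqsubset> \<zeta>" using 3 that by blast
            moreover have "\<gamma> \<sqsubset> \<zeta>" using \<open>\<xi> \<in> ?I\<close> that(2) lt_le_trans lt_Field(1)[OF \<open>\<zeta> \<sqsubset> \<alpha>\<close>] by auto
            ultimately show False by blast
          qed
          moreover have "\<not> ?\<eta> \<sqsubset> \<xi>" using that \<eta>(2) lt_trans by blast
          ultimately have "is_next \<xi> \<beta> ?\<eta>"
            using is_next_nxt[OF \<alpha>\<beta>] unfolding is_next_def by blast
          then have "nxt \<xi> \<beta> = ?\<eta>" by (rule nxt_eqI[OF \<xi>])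
          then show ?thesis using rho_step[OF \<xi>] by simp
        qed
        then show ?thesis unfolding near_def by (intro exI[of _ 1]) auto
      qed
      ultimately have "near ?I \<alpha> \<beta>" by (rule near_trans)
      \<comment> \<open>The comparison passes through \<gamma>: the outer hypothesis relates it to
        \<alpha>, the inner one to \<beta>.\<close>
      moreover have "near (underS \<gamma>) \<alpha> \<beta>"
        using near_trans[OF near_sym[OF IH\<beta>[OF \<alpha>\<beta> 3(1)]] IH\<alpha>[OF 3(1) lt_trans[OF 3(1) \<alpha>\<beta>]]] .
      ultimately have "near (underS \<gamma> \<union> ({\<gamma>} \<union> ?I)) \<alpha> \<beta>"
        by (intro near_Un near_singleton)
      then show ?thesis
      proof (rule near_mono)
        show "underS \<alpha> \<subseteq> underS \<gamma> \<union> ({\<gamma>} \<union> ?I)"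
          using lt_linear lt_Field 3(1) by blast
      qed
    qed
  qed
qed

lemma near_Int:
  assumes "\<alpha> \<in> K" "\<beta> \<in> K" shows "near (underS \<alpha> \<inter> underS \<beta>) \<alpha> \<beta>"
  using lt_linear[OF assms] near_lt near_sym near_mono near_refl by (metis inf_le1 inf_le2)

subsection \<open>Unboundedness\<close>

text \<open>The bound is asked only below \<delta>, not below \<beta>, so that \<beta> may be
  replaced by a later point of its walk towards \<delta>.\<close>

definition dominated :: "nat \<Rightarrow> 'a set \<Rightarrow> 'a \<Rightarrow> 'a \<Rightarrow> bool" where
  "dominated n A \<delta> \<beta> \<longleftrightarrow> \<beta> \<in> K \<and> \<not> \<beta> \<sqsubset> \<delta> \<and> (\<forall>\<xi>\<in>A. \<xi> \<sqsubset> \<delta> \<longrightarrow> rho \<xi> \<beta> \<le> n)"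

lemma dominated_mono: "dominated n A \<delta> \<beta> \<Longrightarrow> \<delta>' \<sqsubset> \<delta> \<Longrightarrow> dominated n A \<delta>' \<beta>"
  unfolding dominated_def using lt_trans by blast

text \<open>A thread arises as soon as every point dominating \<open>\<delta>\<close> has \<open>\<delta>\<close> as a limit point of its club,
  for unboundedly many \<open>\<delta>\<close>: such \<open>\<delta>\<close> then dominate each other.\<close>

lemma dominated_not_all_limit:
  assumes D: "unbounded D"
    and dom: "\<And>\<delta>. \<delta> \<in> K \<Longrightarrow> \<exists>\<beta>. dominated n A \<delta> \<beta>"
    and lim: "\<And>\<delta> \<beta>. \<delta> \<in> D \<Longrightarrow> dominated n A \<delta> \<beta> \<Longrightarrow> \<delta> \<in> limit_points \<kappa> (C \<beta>)"
  shows False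
proof -
  have DK: "\<delta> \<in> K" if "\<delta> \<in> D" for \<delta> using D that by (auto simp: unbounded_def)
  \<comment> \<open>Since \<delta> is a limit point of \<open>C \<beta>\<close>, \<open>rho\<close>
    takes the same values at \<delta> as at \<beta> below \<delta>, so the bound passes from \<beta>
    to \<delta>.\<close>
  have self: "dominated n A \<delta> \<delta>" if \<delta>: "\<delta> \<in> D" for \<delta>
  proof -
    obtain \<beta> where \<beta>: "dominated n A \<delta> \<beta>" using dom DK \<delta> by blast
    with lim[OF \<delta> \<beta>] rho_limit_point[of \<beta> \<delta>] show ?thesis
      using DK[OF \<delta>] unfolding dominated_def by auto
  qed
  have lim_self: "\<delta> \<in> limit_points \<kappa> (C \<delta>)" if "\<delta> \<in> D" for \<delta>
    using lim self that by blast
  have initial: "C \<delta>' \<inter> underS \<delta> = C \<delta>" if "\<delta> \<in> D" "\<delta>' \<in> D" "\<delta> \<sqsubset> \<delta>'" for \<delta> \<delta>'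
    using coherent[OF DK lim[OF that(1) dominated_mono[OF self]]] that by blast
  have sub: "C \<delta> \<subseteq> underS \<delta>" if "\<delta> \<in> D" for \<delta>
    using C_below(1) limit_pointsD(2)[OF lim_self[OF that]] by blast
  \<comment> \<open>The clubs \<open>C \<delta>\<close> for \<delta> in \<open>D\<close> end-extend
    one another; their union is the thread.\<close>
  define E where "E = (\<Union>\<delta>\<in>D. C \<delta>)"
  have E: "E \<inter> underS \<delta> = C \<delta>" if \<delta>: "\<delta> \<in> D" for \<delta>
  proof -
    have "C \<delta>' \<inter> underS \<delta> \<subseteq> C \<delta>" if "\<delta>' \<in> D" for \<delta>'
      using lt_linear[OF DK[OF \<delta>] DK[OF that]] initial \<delta> that by blast
    then show ?thesis unfolding E_def using sub \<delta> by blast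
  qed
  have lim_E: "\<alpha> \<in> E \<and> E \<inter> underS \<alpha> = C \<alpha>" if \<alpha>: "\<alpha> \<in> limit_points \<kappa> E" for \<alpha>
  proof -
    obtain \<delta> where \<delta>: "\<delta> \<in> D" "\<alpha> \<sqsubset> \<delta>"
      using D limit_pointsD(1)[OF \<alpha>] by (auto simp: unbounded_def)
    have eq: "E \<inter> underS \<alpha> = C \<delta> \<inter> underS \<alpha>" using E[OF \<delta>(1)] \<delta>(2) lt_trans by blast
    then have \<alpha>': "\<alpha> \<in> limit_points \<kappa> (C \<delta>)" using limit_points_mono[OF _ \<alpha>] by blast
    \<comment> \<open>Only at limit ordinals is \<open>C \<delta>\<close> known to be closed, which
      puts \<alpha> into \<open>E\<close>.\<close>
    have "\<delta> \<in> limit_ordinals \<kappa>"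
      using limit_points_mono[OF _ lim_self[OF \<delta>(1)]] lt_Field by blast
    then have "\<alpha> \<in> C \<delta>" using club \<alpha>' \<delta>(2) unfolding club_in_def by blast
    then show ?thesis using eq coherent[OF DK[OF \<delta>(1)] \<alpha>'] \<delta>(1) unfolding E_def by blast
  qed
  have "club_in \<kappa> K E"
    unfolding club_in_def
  proof (intro conjI ballI)
    show "E \<subseteq> K" using sub lt_Field unfolding E_def by blast
    show "limit_points \<kappa> E \<inter> K \<subseteq> E" using lim_E by blast
    fix \<gamma> assume "\<gamma> \<in> K"
    then obtain \<delta> where "\<delta> \<in> D" "\<gamma> \<sqsubset> \<delta>" using D by (auto simp: unbounded_def)
    then show "\<exists>\<delta>\<in>E. \<gamma> \<sqsubset> \<delta>" using limit_pointsD(3)[OF lim_self, of \<delta> \<gamma>] by (auto simp: E_def)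
  qed
  then show False using no_thread lim_E by blast
qed

text \<open>Induction on the bound. For \<open>n = 0\<close> a point of \<open>A\<close> below
  \<delta> already needs one step. For \<open>Suc n\<close>, failure would give unboundedly many
  \<delta> that are limit points of \<open>C \<beta>\<close> for every dominating \<beta>,
  contradicting \<open>dominated_not_all_limit\<close>.\<close>

lemma ex_not_dominated:
  assumes "unbounded A" shows "\<exists>\<delta>\<in>K. \<forall>\<beta>. \<not> dominated n A \<delta> \<beta>"
  using assms
proof (induction n arbitrary: A)
  case 0
  then obtain x where "x \<in> K" "x \<in> A"
    using Field_nonempty by (fastforce simp: unbounded_def)
  then obtain \<delta> where "x \<sqsubset> \<delta>" "\<delta> \<in> K" using ex_greater by blast
  have "\<not> dominated 0 A \<delta> \<beta>" for \<beta>
    using \<open>x \<sqsubset> \<delta>\<close> \<open>x \<in> A\<close> rho_step[of x \<beta>] lt_le_trans[of x \<delta> \<beta>] by (auto simp: dominated_def)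
  then show ?case using \<open>\<delta> \<in> K\<close> by blast
next
  case (Suc n)
  show ?case
  proof (rule ccontr)
    assume "\<not> ?thesis"
    then have dom: "\<exists>\<beta>. dominated (Suc n) A \<delta> \<beta>" if "\<delta> \<in> K" for \<delta> using that by blast
    \<comment> \<open>\<open>S \<sigma>\<close> collects the bad \<delta>: some dominating \<beta>
      has a club with no point strictly between \<sigma> and \<delta>.\<close>
    define S where "S \<sigma> = {\<delta>\<in>K. \<exists>\<beta>. dominated (Suc n) A \<delta> \<beta> \<and> (\<forall>\<eta>\<in>C \<beta>. \<eta> \<sqsubset> \<delta> \<longrightarrow> \<not> \<sigma> \<sqsubset> \<eta>)}" for \<sigma>
    have S_mono: "S \<sigma> \<subseteq> S \<sigma>'" if "\<not> \<sigma>' \<sqsubset> \<sigma>" "\<sigma> \<in> K" "\<sigma>' \<in> K" for \<sigma> \<sigma>'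
      unfolding S_def using that le_lt_trans by blast
    have "\<exists>\<tau>\<in>K. \<sigma> \<sqsubset> \<tau> \<and> S \<sigma> \<subseteq> underS \<tau>" if \<sigma>: "\<sigma> \<in> K" for \<sigma>
    proof -
      \<comment> \<open>For \<open>\<delta> \<in> S \<sigma>\<close> the walks from \<open>\<beta>\<close> to all \<open>\<xi>\<close> strictly between \<open>\<sigma>\<close> and \<open>\<delta>\<close> share their first step.
        Dropping that step turns \<open>Suc n\<close> into \<open>n\<close>.\<close>
      have "\<not> unbounded (S \<sigma>)"
      proof
        assume unb: "unbounded (S \<sigma>)"
        let ?A = "{\<xi>\<in>A. \<sigma> \<sqsubset> \<xi>}"
        have "unbounded ?A"
          unfolding unbounded_def
        proof (intro conjI ballI)
          show "?A \<subseteq> K" using Suc.prems by (auto simp: unbounded_def)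
          fix \<gamma> assume \<gamma>: "\<gamma> \<in> K"
          obtain \<gamma>' where "\<gamma>' \<in> K" "\<not> \<gamma>' \<sqsubset> \<gamma>" "\<not> \<gamma>' \<sqsubset> \<sigma>"
            using lt_linear[OF \<sigma> \<gamma>] \<sigma> \<gamma> lt_trans lt_irrefl by metis
          then obtain \<xi> where "\<xi> \<in> A" "\<gamma>' \<sqsubset> \<xi>" using Suc.prems by (auto simp: unbounded_def)
          then show "\<exists>\<xi>\<in>?A. \<gamma> \<sqsubset> \<xi>"
            using le_lt_trans \<open>\<not> \<gamma>' \<sqsubset> \<gamma>\<close> \<open>\<not> \<gamma>' \<sqsubset> \<sigma>\<close> \<gamma> \<sigma> by blast
        qed
        then obtain \<delta> where \<delta>: "\<delta> \<in> K" "\<And>\<beta>. \<not> dominated n ?A \<delta> \<beta>" using Suc.IH by blast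
        \<comment> \<open>The \<delta> from the induction hypothesis need not lie in
          \<open>S \<sigma>\<close>; a member \<delta>' above it does, and domination up to
          \<delta>' includes domination up to \<delta>.\<close>
        obtain \<delta>' where \<delta>': "\<delta> \<sqsubset> \<delta>'" "\<delta>' \<in> S \<sigma>" using unb \<delta>(1) by (auto simp: unbounded_def)
        then obtain \<beta> where \<beta>: "dominated (Suc n) A \<delta>' \<beta>" "\<And>\<eta>. \<eta> \<in> C \<beta> \<Longrightarrow> \<eta> \<sqsubset> \<delta>' \<Longrightarrow> \<not> \<sigma> \<sqsubset> \<eta>"
          unfolding S_def by blast
        have lt: "\<delta> \<sqsubset> \<beta>" using \<delta>'(1) \<beta>(1) lt_le_trans unfolding dominated_def by blast
        have "dominated n ?A \<delta> (nxt \<delta> \<beta>)"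
          unfolding dominated_def
        proof (intro conjI ballI impI)
          show "nxt \<delta> \<beta> \<in> K" "\<not> nxt \<delta> \<beta> \<sqsubset> \<delta>" using nxt_lt[OF lt] lt_Field by blast+
          fix \<xi> assume \<xi>: "\<xi> \<in> ?A" "\<xi> \<sqsubset> \<delta>"
          have \<xi>\<beta>: "\<xi> \<sqsubset> \<beta>" using \<xi>(2) lt lt_trans by blast
          have "is_next \<delta> \<beta> (nxt \<delta> \<beta>)" by (rule is_next_nxt[OF lt])
          moreover have "\<not> \<zeta> \<sqsubset> \<delta>'" if "\<zeta> \<in> C \<beta>" "\<not> \<zeta> \<sqsubset> \<xi>" for \<zeta>
            using \<beta>(2)[OF that(1)] \<xi>(1) that(2) lt_le_trans lt_Field by blast
          ultimately have "is_next \<xi> \<beta> (nxt \<delta> \<beta>)"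
            using \<xi>(2) \<delta>'(1) lt_trans unfolding is_next_def by blast
          then have "rho \<xi> \<beta> = Suc (rho \<xi> (nxt \<delta> \<beta>))"
            using rho_step[OF \<xi>\<beta>] nxt_eqI[OF \<xi>\<beta>] by simp
          moreover have "rho \<xi> \<beta> \<le> Suc n"
            using \<beta>(1) \<xi> \<delta>'(1) lt_trans unfolding dominated_def by blast
          ultimately show "rho \<xi> (nxt \<delta> \<beta>) \<le> n" by simp
        qed
        then show False using \<delta>(2) by blast
      qed
      then obtain \<tau> where "\<tau> \<in> K" "S \<sigma> \<subseteq> underS \<tau>"
        using not_unbounded_bounded[of "S \<sigma>"] unfolding S_def by blast
      moreover obtain \<tau>' where "\<sigma> \<sqsubset> \<tau>'" "\<tau>' \<in> K" using ex_greater[OF \<sigma>] by blast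
      ultimately show ?thesis using lt_linear[of \<tau> \<tau>'] lt_trans by blast
    qed
    then obtain g where g: "\<And>\<sigma>. \<sigma> \<in> K \<Longrightarrow> g \<sigma> \<in> K" "\<And>\<sigma>. \<sigma> \<in> K \<Longrightarrow> \<sigma> \<sqsubset> g \<sigma>"
      "\<And>\<sigma>. \<sigma> \<in> K \<Longrightarrow> S \<sigma> \<subseteq> underS (g \<sigma>)" by metis
    \<comment> \<open>A diagonal intersection: the nonzero \<delta> that are bad for no \<sigma>
      below \<delta>. At such \<delta> the club of every dominating \<beta> is cofinal in
      \<delta>.\<close>
    define D where "D = {\<delta>\<in>K. (\<exists>\<gamma>. \<gamma> \<sqsubset> \<delta>) \<and> (\<forall>\<sigma>. \<sigma> \<sqsubset> \<delta> \<longrightarrow> \<delta> \<notin> S \<sigma>)}"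
    have "unbounded D"
      unfolding unbounded_def
    proof (intro conjI ballI)
      show "D \<subseteq> K" unfolding D_def by blast
      fix \<gamma> assume \<gamma>: "\<gamma> \<in> K"
      \<comment> \<open>The supremum \<delta> of the iterates of \<open>g\<close> from \<gamma> is
        closed under the bounds. Any \<sigma> below \<delta> is at most some \<open>d k\<close>, so
        \<delta> in \<open>S \<sigma>\<close> would place \<delta> below
        \<open>d (Suc k)\<close>.\<close>
      define d where "d k = (g ^^ k) \<gamma>" for k
      have dK: "d k \<in> K" for k unfolding d_def by (induction k) (auto simp: \<gamma> g)
      have d_Suc: "d (Suc k) = g (d k)" for k unfolding d_def by simp
      obtain \<beta> where "\<beta> \<in> {\<beta>\<in>K. range d \<subseteq> underS \<beta>}"
        using countable_bounded[of "range d"] dK by auto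
      from ex_least[OF this] obtain \<delta> where \<delta>: "\<delta> \<in> K" "\<And>k. d k \<sqsubset> \<delta>"
        and least: "\<And>\<sigma>. \<sigma> \<in> K \<Longrightarrow> range d \<subseteq> underS \<sigma> \<Longrightarrow> \<not> \<sigma> \<sqsubset> \<delta>"
        by blast
      have "\<gamma> \<sqsubset> \<delta>" using \<delta>(2)[of 0] by (simp add: d_def)
      moreover have "\<delta> \<notin> S \<sigma>" if \<sigma>: "\<sigma> \<sqsubset> \<delta>" for \<sigma>
      proof
        assume "\<delta> \<in> S \<sigma>"
        obtain k where "\<not> d k \<sqsubset> \<sigma>" using least lt_Field \<sigma> by blast
        then have "\<delta> \<in> S (d k)" using S_mono[of "d k" \<sigma>] \<open>\<delta> \<in> S \<sigma>\<close> dK lt_Field \<sigma> by blast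
        then have "\<delta> \<sqsubset> d (Suc k)" using g(3)[OF dK] unfolding d_Suc by blast
        then show False using \<delta>(2) lt_trans lt_irrefl by metis
      qed
      ultimately show "\<exists>\<delta>\<in>D. \<gamma> \<sqsubset> \<delta>" using \<delta>(1) unfolding D_def by blast
    qed
    moreover have "\<delta> \<in> limit_points \<kappa> (C \<beta>)" if "\<delta> \<in> D" "dominated (Suc n) A \<delta> \<beta>" for \<delta> \<beta>
      using that unfolding D_def S_def limit_points_def by blast
    ultimately show False using dominated_not_all_limit dom by blast
  qed
qed

section \<open>The ideal of slow sets\<close>

definition slow :: "'a set \<Rightarrow> bool" where
  "slow B \<longleftrightarrow> B \<subseteq> K \<and> (\<forall>\<beta>\<in>K. \<exists>m. \<forall>\<xi>\<in>B. \<xi> \<sqsubset> \<beta> \<longrightarrow> rho \<xi> \<beta> \<le> m)"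

text \<open>The bound for \<open>A\<close> below \<beta> depends on \<beta>, but takes only
  countably many values. One \<open>n\<close> therefore serves unboundedly many \<beta>, and these
  dominate at every \<delta>, against \<open>ex_not_dominated\<close>.\<close>

lemma slow_not_unbounded:
  assumes "slow A" shows "\<not> unbounded A"
proof
  assume A: "unbounded A"
  let ?F = "\<lambda>n. {\<beta>\<in>K. \<forall>\<xi>\<in>A. \<xi> \<sqsubset> \<beta> \<longrightarrow> rho \<xi> \<beta> \<le> n}"
  have "K \<subseteq> (\<Union>n. ?F n)" using assms by (auto simp: slow_def)
  then obtain n where n: "unbounded (K \<inter> ?F n)"
    using countable_union_unbounded[OF unbounded_Field, of ?F] by auto
  have dom: "\<exists>\<beta>. dominated n A \<delta> \<beta>" if "\<delta> \<in> K" for \<delta>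
  proof -
    from n have "\<forall>\<gamma>\<in>K. \<exists>\<beta>\<in>K \<inter> ?F n. \<gamma> \<sqsubset> \<beta>" unfolding unbounded_def by (rule conjunct2)
    from bspec[OF this that] obtain \<beta> where \<beta>: "\<beta> \<in> K \<inter> ?F n" "\<delta> \<sqsubset> \<beta>" by (rule bexE)
    have "\<xi> \<sqsubset> \<beta>" if "\<xi> \<sqsubset> \<delta>" for \<xi> using lt_trans[OF that \<beta>(2)] .
    moreover have "\<not> \<beta> \<sqsubset> \<delta>" using lt_trans[OF \<beta>(2)] lt_irrefl by metis
    ultimately have "dominated n A \<delta> \<beta>" using \<beta>(1) by (simp add: dominated_def)
    then show ?thesis ..
  qed
  from ex_not_dominated[OF A] obtain \<delta> where \<delta>: "\<delta> \<in> K" "\<forall>\<beta>. \<not> dominated n A \<delta> \<beta>"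
    by (rule bexE)
  with dom[OF \<delta>(1)] show False by simp
qed

lemma slow_subset:
  assumes "slow B" "A \<subseteq> B" shows "slow A"
  unfolding slow_def
proof (intro conjI ballI)
  show "A \<subseteq> K" using assms by (auto simp: slow_def)
  fix \<beta> assume "\<beta> \<in> K"
  then obtain m where "\<forall>\<xi>\<in>B. \<xi> \<sqsubset> \<beta> \<longrightarrow> rho \<xi> \<beta> \<le> m"
    using assms(1) by (auto simp: slow_def)
  then show "\<exists>m. \<forall>\<xi>\<in>A. \<xi> \<sqsubset> \<beta> \<longrightarrow> rho \<xi> \<beta> \<le> m"
    using assms(2) by (intro exI[of _ m]) auto
qed

lemma slow_empty [simp]: "slow {}"
  by (simp add: slow_def)

lemma slow_Un:
  assumes "slow A" "slow B" shows "slow (A \<union> B)"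
  unfolding slow_def
proof (intro conjI ballI)
  show "A \<union> B \<subseteq> K" using assms by (simp add: slow_def)
  fix \<beta> assume "\<beta> \<in> K"
  then obtain m n where "\<forall>\<xi>\<in>A. \<xi> \<sqsubset> \<beta> \<longrightarrow> rho \<xi> \<beta> \<le> m" "\<forall>\<xi>\<in>B. \<xi> \<sqsubset> \<beta> \<longrightarrow> rho \<xi> \<beta> \<le> n"
    using assms unfolding slow_def by metis
  then show "\<exists>m. \<forall>\<xi>\<in>A \<union> B. \<xi> \<sqsubset> \<beta> \<longrightarrow> rho \<xi> \<beta> \<le> m"
    by (intro exI[of _ "max m n"]) (auto simp: le_max_iff_disj)
qed

text \<open>Coherence carries the bound \<open>m\<close> at \<beta> to a bound \<open>m + k\<close>
  at any other \<gamma>.\<close>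

lemma slow_below:
  assumes "\<beta> \<in> K" shows "slow {\<xi>. \<xi> \<sqsubset> \<beta> \<and> rho \<xi> \<beta> \<le> m}"
  unfolding slow_def
proof (intro conjI ballI)
  show "{\<xi>. \<xi> \<sqsubset> \<beta> \<and> rho \<xi> \<beta> \<le> m} \<subseteq> K" by (auto intro: lt_Field)
  fix \<gamma> assume "\<gamma> \<in> K"
  from near_Int[OF this assms] obtain k where
    "\<forall>\<xi>\<in>underS \<gamma> \<inter> underS \<beta>. rho \<xi> \<gamma> \<le> rho \<xi> \<beta> + k \<and> rho \<xi> \<beta> \<le> rho \<xi> \<gamma> + k"
    unfolding near_def by blast
  then show "\<exists>n. \<forall>\<xi>\<in>{\<xi>. \<xi> \<sqsubset> \<beta> \<and> rho \<xi> \<beta> \<le> m}. \<xi> \<sqsubset> \<gamma> \<longrightarrow> rho \<xi> \<gamma> \<le> n"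
    by (intro exI[of _ "m + k"]) force
qed

section \<open>The space\<close>

text \<open>An arbitrary ordinal in \<open>K\<close> serves as the nonisolated point, which keeps
  the space on the type of \<kappa>. Hence the recurring condition that a slow set avoid
  \<open>pt\<close> before its complement is a neighbourhood.\<close>

definition pt :: 'a where "pt = (SOME x. x \<in> K)"

lemma pt_Field: "pt \<in> K"
  unfolding pt_def using Field_nonempty by (rule some_in_eq[THEN iffD2])

definition X :: "'a topology" where
  "X = topology (\<lambda>U. U \<subseteq> K \<and> (pt \<in> U \<longrightarrow> slow (K - U)))"

lemma openin_X: "openin X U \<longleftrightarrow> U \<subseteq> K \<and> (pt \<in> U \<longrightarrow> slow (K - U))"
proof -
  have "istopology (\<lambda>U. U \<subseteq> K \<and> (pt \<in> U \<longrightarrow> slow (K - U)))"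
    unfolding istopology_def
  proof (rule conjI; intro allI impI conjI)
    fix S T assume "S \<subseteq> K \<and> (pt \<in> S \<longrightarrow> slow (K - S))" "T \<subseteq> K \<and> (pt \<in> T \<longrightarrow> slow (K - T))" "pt \<in> S \<inter> T"
    then show "slow (K - S \<inter> T)" using slow_Un[of "K - S" "K - T"] by (simp add: Diff_Int)
  next
    fix \<U> assume *: "\<forall>S\<in>\<U>. S \<subseteq> K \<and> (pt \<in> S \<longrightarrow> slow (K - S))" and "pt \<in> \<Union>\<U>"
    then obtain S where "S \<in> \<U>" "slow (K - S)" by auto
    then show "slow (K - \<Union>\<U>)" by (elim slow_subset) auto
  qed auto
  then show ?thesis unfolding X_def by (simp add: topology_inverse')
qed

lemma topspace_X [simp]: "topspace X = K"
proof
  show "topspace X \<subseteq> K" using openin_topspace[of X] openin_X by blast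
  show "K \<subseteq> topspace X" by (rule openin_subset) (simp add: openin_X)
qed

lemma openin_complement_slow: "slow B \<Longrightarrow> pt \<notin> B \<Longrightarrow> openin X (K - B)"
  by (auto simp: openin_X intro: slow_subset)

lemma openin_singleton: "x \<in> K \<Longrightarrow> x \<noteq> pt \<Longrightarrow> openin X {x}"
  by (auto simp: openin_X)

section \<open>Convergence to the nonisolated point and the Frechet property\<close>

lemma limitin_pt:
  assumes "range s \<subseteq> K"
  shows "limitin X s pt sequentially \<longleftrightarrow>
    (\<forall>B. slow B \<longrightarrow> pt \<notin> B \<longrightarrow> (\<forall>\<^sub>F n in sequentially. s n \<notin> B))"
proof (intro iffI allI impI)
  fix B assume "limitin X s pt sequentially" "slow B" "pt \<notin> B"
  then have "\<forall>\<^sub>F n in sequentially. s n \<in> K - B"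
    using openin_complement_slow pt_Field unfolding limitin_def by blast
  then show "\<forall>\<^sub>F n in sequentially. s n \<notin> B" by eventually_elim simp
next
  assume *: "\<forall>B. slow B \<longrightarrow> pt \<notin> B \<longrightarrow> (\<forall>\<^sub>F n in sequentially. s n \<notin> B)"
  show "limitin X s pt sequentially"
    unfolding limitin_def
  proof (intro conjI allI impI)
    show "pt \<in> topspace X" by (simp add: pt_Field)
    fix U assume "openin X U \<and> pt \<in> U"
    then have "slow (K - U)" "pt \<notin> K - U" by (auto simp: openin_X)
    with * have "\<forall>\<^sub>F n in sequentially. s n \<notin> K - U" by blast
    then show "\<forall>\<^sub>F n in sequentially. s n \<in> U" by eventually_elim (use assms in auto)
  qed
qed

lemma Frechet_X: "Frechet_space X"
  unfolding Frechet_space_def Frechet_point_def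
proof (intro ballI allI impI iffI)
  fix x A
  assume "\<exists>s. range s \<subseteq> A \<and> limitin X s x sequentially"
  then obtain s where s: "range s \<subseteq> A" "limitin X s x sequentially" by blast
  show "x \<in> X closure_of A"
    unfolding in_closure_of
  proof (intro conjI allI impI)
    show "x \<in> topspace X" using s(2) by (simp add: limitin_def)
    fix T assume "x \<in> T \<and> openin X T"
    then have "\<forall>\<^sub>F n in sequentially. s n \<in> T" using s(2) by (simp add: limitin_def)
    then obtain n where "s n \<in> T" by (metis eventually_happens' sequentially_bot)
    then show "\<exists>y. y \<in> A \<and> y \<in> T" using s(1) by blast
  qed
next
  fix x A
  assume A: "A \<subseteq> topspace X" and x: "x \<in> X closure_of A"
  show "\<exists>s. range s \<subseteq> A \<and> limitin X s x sequentially"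
  proof (cases "x \<in> A")
    case True
    then show ?thesis using A by (intro exI[of _ "\<lambda>_. x"]) (auto simp: limitin_const_iff)
  next
    case False
    have "x \<in> K" using x by (simp add: in_closure_of)
    have "x = pt"
    proof (rule ccontr)
      assume "x \<noteq> pt"
      with \<open>x \<in> K\<close> have "openin X {x}" by (rule openin_singleton)
      then show False using x False by (auto simp: in_closure_of)
    qed
    have "\<not> slow A"
    proof
      assume "slow A"
      then have "openin X (K - A)" using False \<open>x = pt\<close> openin_complement_slow by blast
      then show False using x \<open>x \<in> K\<close> False by (auto simp: in_closure_of)
    qed
    \<comment> \<open>Failure of slowness is witnessed at a single \<beta>, along which
      \<open>rho\<close> is unbounded on \<open>A\<close>. Points with ever larger values form the
      sequence.\<close>
    then obtain \<beta> where \<beta>: "\<beta> \<in> K" "\<forall>m. \<exists>\<xi>\<in>A. \<xi> \<sqsubset> \<beta> \<and> m < rho \<xi> \<beta>"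
      using A unfolding slow_def by (auto simp: not_le)
    then obtain s where s: "\<And>m. s m \<in> A" "\<And>m. s m \<sqsubset> \<beta>" "\<And>m. m < rho (s m) \<beta>" by metis
    have "range s \<subseteq> K" using s(2) lt_Field(1) by auto
    then have "limitin X s pt sequentially"
    proof (subst limitin_pt, simp, intro allI impI)
      fix B assume "slow B"
      then obtain m where m: "\<forall>\<xi>\<in>B. \<xi> \<sqsubset> \<beta> \<longrightarrow> rho \<xi> \<beta> \<le> m" using \<beta>(1) unfolding slow_def by blast
      have "s n \<notin> B" if "m \<le> n" for n
        using m s(2)[of n] s(3)[of n] that by fastforce
      then show "\<forall>\<^sub>F n in sequentially. s n \<notin> B" unfolding eventually_sequentially by blast
    qed
    then show ?thesis using s(1) \<open>x = pt\<close> by auto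
  qed
qed

section \<open>The property alpha_1\<close>

lemma finite_slow_range:
  assumes "s \<in> converging_seqs X pt" "slow B" "pt \<notin> B"
  shows "finite (range s \<inter> B)"
proof -
  have "\<forall>\<^sub>F n in sequentially. s n \<notin> B"
    using assms limitin_pt[of s] by (simp add: converging_seqs_def)
  then obtain N where "\<And>n. N \<le> n \<Longrightarrow> s n \<notin> B" by (auto simp: eventually_sequentially)
  then have "range s \<inter> B \<subseteq> s ` {..<N}" by (auto intro!: imageI simp: not_le[symmetric])
  then show ?thesis using finite_subset by blast
qed

lemma ex_converging_seq:
  assumes "countable A" "A \<subseteq> K" and fin: "\<And>B. slow B \<Longrightarrow> pt \<notin> B \<Longrightarrow> finite (A \<inter> B)"
  shows "\<exists>t\<in>converging_seqs X pt. A \<subseteq> range t"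
proof -
  define t where "t n = (if n \<in> to_nat_on A ` A then from_nat_into A n else pt)" for n
  have tA: "t (to_nat_on A x) = x" if "x \<in> A" for x
    using that assms(1) by (auto simp: t_def)
  have t_cases: "(\<exists>x\<in>A. n = to_nat_on A x \<and> t n = x) \<or> t n = pt" for n
    using tA by (cases "n \<in> to_nat_on A ` A") (auto simp: t_def)
  have ran: "range t \<subseteq> K"
    using t_cases pt_Field assms(2) by (metis image_subsetI subsetD)
  have "limitin X t pt sequentially"
  proof (subst limitin_pt[OF ran], intro allI impI)
    fix B assume B: "slow B" "pt \<notin> B"
    have "{n. t n \<in> B} \<subseteq> to_nat_on A ` (A \<inter> B)"
    proof
      fix n assume "n \<in> {n. t n \<in> B}"
      with t_cases[of n] B(2) show "n \<in> to_nat_on A ` (A \<inter> B)" by auto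
    qed
    then have "finite {n. t n \<in> B}" using fin[OF B] finite_subset by blast
    then show "\<forall>\<^sub>F n in sequentially. t n \<notin> B"
      by (simp add: cofinite_eq_sequentially[symmetric] eventually_cofinite)
  qed
  then show ?thesis
    using ran tA by (intro bexI[of _ t]) (auto simp: converging_seqs_def, metis rangeI)
qed

text \<open>All the ranges lie below one \<beta>, so \<open>rho\<close> at \<beta> tests convergence
  for all of them at once. Removing finitely many points from each range, more as the index grows,
  makes the union converge.\<close>

lemma alpha1_pt: "alpha1_point X pt"
  unfolding alpha1_point_def
proof (intro allI impI)
  fix S assume S: "S \<subseteq> converging_seqs X pt" "countable S"
  have SK: "range s \<subseteq> K" if "s \<in> S" for s
    using that S(1) by (auto simp: converging_seqs_def)
  have "\<exists>\<beta>\<in>K. (\<Union>s\<in>S. range s) \<subseteq> underS \<beta>"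
    by (rule countable_bounded) (use SK S(2) in auto)
  then obtain \<beta> where "\<beta> \<in> K" and ranges: "(\<Union>s\<in>S. range s) \<subseteq> underS \<beta>" by (rule bexE)
  have \<beta>: "\<beta> \<in> K" "\<And>s n. s \<in> S \<Longrightarrow> s n \<sqsubset> \<beta>"
    using \<open>\<beta> \<in> K\<close> ranges by auto
  define i where "i = to_nat_on S"
  have inj: "inj_on i S" unfolding i_def using S(2) by (rule inj_on_to_nat_on)
  define low where "low m = {\<xi>. \<xi> \<sqsubset> \<beta> \<and> rho \<xi> \<beta> \<le> m} - {pt}" for m
  have slow_low: "slow (low m)" for m
    unfolding low_def by (rule slow_subset[OF slow_below[OF \<beta>(1)]]) auto
  have fin_low: "finite (range s \<inter> low m)" if "s \<in> S" for s m
    using finite_slow_range[OF _ slow_low] S(1) that by (auto simp: low_def)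
  \<comment> \<open>Apart from \<open>pt\<close>, the points kept from the sequence of index
    \<open>i s\<close> have \<open>rho\<close> at \<beta> above \<open>i s\<close>.\<close>
  define A where "A = (\<Union>s\<in>S. range s - low (i s))"
  have "\<exists>t\<in>converging_seqs X pt. A \<subseteq> range t"
  proof (rule ex_converging_seq)
    show "countable A" unfolding A_def using S(2) by auto
    show "A \<subseteq> K" unfolding A_def using SK by blast
    fix B assume B: "slow B" "pt \<notin> B"
    then obtain m where m: "\<forall>\<xi>\<in>B. \<xi> \<sqsubset> \<beta> \<longrightarrow> rho \<xi> \<beta> \<le> m" using \<beta>(1) unfolding slow_def by blast
    \<comment> \<open>If \<open>rho\<close> is at most \<open>m\<close> on \<open>B\<close> below
      \<beta>, only sequences of index below \<open>m\<close> can meet \<open>B\<close>, each in a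
      finite set.\<close>
    have "A \<inter> B \<subseteq> (\<Union>s\<in>{s\<in>S. i s < m}. range s \<inter> low m)"
    proof
      fix x assume x: "x \<in> A \<inter> B"
      then obtain s where s: "s \<in> S" "x \<in> range s" "x \<notin> low (i s)" unfolding A_def by blast
      then have "x \<sqsubset> \<beta>" using \<beta>(2) by blast
      moreover have "rho x \<beta> \<le> m" "x \<noteq> pt" using m x \<open>x \<sqsubset> \<beta>\<close> B(2) by auto
      ultimately have "x \<in> low m" "i s < m" using s(3) by (auto simp: low_def)
      then show "x \<in> (\<Union>s\<in>{s\<in>S. i s < m}. range s \<inter> low m)" using s by blast
    qed
    moreover have "finite {s\<in>S. i s < m}"
    proof (rule finite_imageD)
      show "finite (i ` {s\<in>S. i s < m})" by (rule finite_subset[of _ "{..<m}"]) auto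
      show "inj_on i {s\<in>S. i s < m}" using inj by (rule inj_on_subset) auto
    qed
    then have "finite (\<Union>s\<in>{s\<in>S. i s < m}. range s \<inter> low m)"
      by (rule finite_UN_I) (rule fin_low, simp)
    ultimately show "finite (A \<inter> B)" by (rule finite_subset)
  qed
  then obtain t where t: "t \<in> converging_seqs X pt" "A \<subseteq> range t" by blast
  have "finite (range s - range t)" if s: "s \<in> S" for s
  proof (rule finite_subset)
    show "range s - range t \<subseteq> range s \<inter> low (i s)" using t(2) s unfolding A_def by blast
  qed (rule fin_low[OF s])
  then show "\<exists>t\<in>converging_seqs X pt. \<forall>s\<in>S. finite (range s - range t)" using t(1) by blast
qed

text \<open>At an isolated point convergent sequences have finite range, so the constant sequence
  contains them all modulo finite sets.\<close>

lemma alpha1_X: "alpha1_space X"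
  unfolding alpha1_space_def
proof
  fix x assume x: "x \<in> topspace X"
  show "alpha1_point X x"
  proof (cases "x = pt")
    case True
    then show ?thesis using alpha1_pt by simp
  next
    case False
    have "finite (range s)" if "s \<in> converging_seqs X x" for s
    proof -
      have "\<forall>\<^sub>F n in sequentially. s n \<in> {x}"
        using that openin_singleton[of x] x False unfolding converging_seqs_def limitin_def by auto
      then obtain N where "\<And>n. N \<le> n \<Longrightarrow> s n = x" by (auto simp: eventually_sequentially)
      then have "range s \<subseteq> insert x (s ` {..<N})" by (auto intro!: imageI simp: not_le[symmetric])
      then show ?thesis using finite_subset by blast
    qed
    moreover have "(\<lambda>_. x) \<in> converging_seqs X x"
      using x by (simp add: converging_seqs_def limitin_const_iff)
    ultimately show ?thesis unfolding alpha1_point_def by blast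
  qed
qed

section \<open>Tightness of the G_delta-modification\<close>

lemma G_delta_closure_pt: "pt \<in> G_delta_modification X closure_of (K - {pt})"
  unfolding in_closure_of
proof (intro conjI allI impI)
  show "pt \<in> topspace (G_delta_modification X)" by (simp add: pt_Field)
  fix T assume "pt \<in> T \<and> openin (G_delta_modification X) T"
  then obtain G where G: "gdelta_in X G" "pt \<in> G" "G \<subseteq> T"
    unfolding openin_G_delta_modification union_of_def by auto
  from G(1) obtain U :: "nat \<Rightarrow> 'a set" where "\<forall>n. openin X (U n)" and UG: "\<Inter> (range U) = G"
    unfolding gdelta_in_descending by (elim exE conjE)
  then have U: "openin X (U n)" for n by simp
  have slow: "slow (K - U n)" for n using U[of n] UG G(2) by (auto simp: openin_X)
  have unb: "unbounded (K - {pt})"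
    unfolding unbounded_def
  proof (intro conjI ballI)
    fix \<gamma> assume "\<gamma> \<in> K"
    \<comment> \<open>Two points above \<gamma> are chosen because one of them may be
      \<open>pt\<close>.\<close>
    then obtain \<delta> \<delta>' where \<delta>: "\<gamma> \<sqsubset> \<delta>" "\<delta> \<sqsubset> \<delta>'" using ex_greater by meson
    then have "\<delta> \<in> K" "\<delta>' \<in> K" "\<gamma> \<sqsubset> \<delta>'" "\<delta> \<noteq> \<delta>'" using lt_Field lt_trans by auto
    with \<delta> show "\<exists>\<xi>\<in>K - {pt}. \<gamma> \<sqsubset> \<xi>" by auto
  qed auto
  show "\<exists>y. y \<in> K - {pt} \<and> y \<in> T"
  proof (rule ccontr)
    assume "\<not> ?thesis"
    \<comment> \<open>If \<open>T\<close> contained only \<open>pt\<close>, the slow complements of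
      the \<open>U n\<close> would cover an unbounded set.\<close>
    then have "K - {pt} \<subseteq> (\<Union>n. K - U n)" using UG G(3) by auto
    from countable_union_unbounded[OF unb this]
    obtain n where "unbounded ((K - {pt}) \<inter> (K - U n))" by (rule exE)
    moreover have "slow ((K - {pt}) \<inter> (K - U n))" by (rule slow_subset[OF slow]) auto
    ultimately show False using slow_not_unbounded by metis
  qed
qed

text \<open>As \<open>rho\<close> is integer-valued, every point below \<beta> falls into one of
  countably many slow sets. The intersection of their complements is a G_delta neighbourhood of
  \<open>pt\<close> missing \<open>B\<close>.\<close>

lemma G_delta_closure_bounded:
  assumes "B \<subseteq> K - {pt}" "B \<subseteq> underS \<beta>" "\<beta> \<in> K"
  shows "pt \<notin> G_delta_modification X closure_of B"
proof
  assume cl: "pt \<in> G_delta_modification X closure_of B"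
  define U where "U m = K - ({\<xi>. \<xi> \<sqsubset> \<beta> \<and> rho \<xi> \<beta> \<le> m} - {pt})" for m
  have "openin X (U m)" for m
    unfolding U_def by (intro openin_complement_slow slow_subset[OF slow_below[OF assms(3)]]) auto
  then have "gdelta_in X (\<Inter> (range U))"
    by (intro gdelta_in_Inter) (auto intro: open_imp_gdelta_in)
  then have "openin (G_delta_modification X) (\<Inter> (range U))"
    unfolding openin_G_delta_modification by (rule arbitrary_union_of_inc)
  moreover have "pt \<in> \<Inter> (range U)" using pt_Field by (simp add: U_def)
  ultimately obtain y where y: "y \<in> B" "y \<in> \<Inter> (range U)" using cl unfolding in_closure_of by blast
  then have "y \<in> U (rho y \<beta>)" by blast
  then show False using y(1) assms(1,2) by (auto simp: U_def)
qed

text \<open>The upper bound holds because the whole space has size \<kappa>. The lower bound is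
  attained at \<open>pt\<close> with the set \<open>K - {pt}\<close>: by regularity a subset of size
  below \<kappa> is bounded and so does not accumulate at \<open>pt\<close>.\<close>

lemma tightness_G_delta_X: "tightness (G_delta_modification X) =o \<kappa>"
proof -
  let ?Y = "G_delta_modification X"
  have "tight_at ?Y x \<kappa>" for x
    unfolding tight_at_def
  proof (intro allI impI)
    fix A assume "A \<subseteq> topspace ?Y" "x \<in> ?Y closure_of A"
    moreover from this have "|A| \<le>o \<kappa>"
      using card_of_mono1[of A K] card_of_Field_ordIso[OF Card_order] ordLeq_ordIso_trans by auto
    ultimately show "\<exists>B\<subseteq>A. |B| \<le>o \<kappa> \<and> x \<in> ?Y closure_of B" by blast
  qed
  then have upper: "tightness ?Y \<le>o \<kappa>"
    by (intro tightness_least(3) tightness_at_least(3) Card_order)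
  have lower: "\<kappa> \<le>o tightness_at pt ?Y"
  proof (rule ccontr)
    assume "\<not> \<kappa> \<le>o tightness_at pt ?Y"
    then have less: "tightness_at pt ?Y <o \<kappa>"
      by (simp only: not_ordLeq_iff_ordLess[OF card_order_on_well_order_on[OF tightness_at_least(1)]
            card_order_on_well_order_on[OF Card_order]] simp_thms)
    obtain B where B: "B \<subseteq> K - {pt}" "|B| \<le>o tightness_at pt ?Y" "pt \<in> ?Y closure_of B"
      using tightness_at_least(2)[of ?Y pt] G_delta_closure_pt unfolding tight_at_def by auto
    have "|B| <o \<kappa>" using B(2) less by (rule ordLeq_ordLess_trans)
    then obtain \<beta> where "\<beta> \<in> K" "B \<subseteq> underS \<beta>" using small_bounded[of B] B(1) by blast
    then show False using G_delta_closure_bounded B by blast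
  qed
  have "tightness_at pt ?Y \<le>o tightness ?Y"
    by (rule tightness_least(2)) (simp add: pt_Field)
  with lower have "\<kappa> \<le>o tightness ?Y" by (rule ordLeq_transitive)
  with upper show ?thesis unfolding ordIso_iff_ordLeq by (rule conjI)
qed

end

theorem theorem3:
  fixes \<kappa> :: "'a rel"
  assumes "Cinfinite \<kappa>" and "regularCard \<kappa>"
    and "square \<kappa>"
  shows "\<exists>X :: 'a topology. Frechet_space X \<and> alpha1_space X \<and>
    tightness (G_delta_modification X) =o \<kappa>"
proof -
  from assms(3) obtain C where C:
    "\<forall>\<alpha>\<in>limit_ordinals \<kappa>. club_in \<kappa> (underS \<kappa> \<alpha>) (C \<alpha>)"
    "\<forall>\<alpha>\<in>Field \<kappa>. C (wo_rel.suc \<kappa> {\<alpha>}) = {\<alpha>}"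
    "\<forall>\<alpha>\<in>Field \<kappa>. \<forall>\<beta>\<in>limit_points \<kappa> (C \<alpha>). C \<alpha> \<inter> underS \<kappa> \<beta> = C \<beta>"
    "\<not> (\<exists>E. club_in \<kappa> (Field \<kappa>) E \<and> (\<forall>\<alpha>\<in>limit_points \<kappa> E. E \<inter> underS \<kappa> \<alpha> = C \<alpha>))"
    unfolding square_def by (elim exE conjE)
  interpret regular_cardinal \<kappa>
    using assms(1,2) by (rule regular_cardinal.intro)
  interpret square_sequence \<kappa> C
    by unfold_locales (metis C)+
  show ?thesis using Frechet_X alpha1_X tightness_G_delta_X by blast
qed

end
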